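(* Let $\alpha<\omega_2$ be an ordinal. If $Y$ is an elementary set of weight $\omega_1$ with Cantor--Bendixson rank $N(Y)=\alpha+1$, then $Y\subset_h J(\alpha+1)$.
   Context: A topological space is a $P$-space if all its $G_\delta$ subsets are open; all spaces here are regular ($T_1$ included). A space is scattered if every non-empty subspace has an isolated point. $X^{(\alpha)}$ is the $\alpha$-th Cantor--Bendixson derivative of $X$, and for scattered $X$, $N(X)$ is the least ordinal with $X^{(N(X))}=\emptyset$. An elementary set is a clopen subset $E$ of a regular scattered $P$-space (regarded as a space itself) such that $N(E)$ is a successor ordinal and $E^{(N(E)-1)}$ is a singleton. $X\subset_h Y$ means that $X$ is homeomorphic to a subspace of $Y$. A $P$-base at a point $x$ of a $P$-space $X$ is a base $\{V_\alpha:\alpha<\omega_1\}$ of neighbourhoods at $x$ such that $V_0=X$, all $V_\alpha$ are clopen, $V_\beta\supseteq V_\alpha$ for $\beta<\alpha<\omega_1$, and $V_\alpha=\bigcap_{\beta<\alpha}V_\beta$ for limit $\alpha<\omega_1$. The sets $V_\alpha\setminus V_{\alpha+1}$ are its slices. The spaces $J(\alpha)$, $\alpha<\omega_2$, are regular $P$-spaces defined (up to homeomorphism) recursively: $J(0)=\emptyset$; $J(1)$ is a singleton; $J(\beta+1)$ is the $P$-space with $J(\beta+1)^{(\beta)}=\{x\}$ a singleton such that there is a $P$-base $\{V_\alpha:\alpha<\omega_1\}$ at $x$ with every slice $V_\alpha\setminus V_{\alpha+1}$ homeomorphic to the topological sum $\bigoplus_{\omega_1}J(\beta)$ of $\omega_1$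 copies of $J(\beta)$; and for an infinite limit ordinal $\beta$, $J(\beta)=\bigoplus\{J(\gamma):\gamma<\beta\}$ (topological sum). *)

theory Defs
  imports "HOL-Analysis.Analysis"
begin

unbundle cardinal_syntax

section \<open>Ordinals\<close>

text \<open>
  The library type \<^typ>\<open>'a suc\<close> is the field of the cardinal successor of \<^term>\<open>|UNIV :: 'a set|\<close>,
  an initial ordinal.  Its elements, ordered by \<^const>\<open>card_suc\<close>, are therefore exactly
  the ordinals of cardinality at most \<^term>\<open>|UNIV :: 'a set|\<close>.
\<close>

instantiation suc :: (type) wellorder
begin

definition less_eq_suc :: "'a suc \<Rightarrow> 'a suc \<Rightarrow> bool" where
  "a \<le> b \<longleftrightarrow> (a, b) \<in> card_suc |UNIV :: 'a set|"

definition less_suc :: "'a suc \<Rightarrow> 'a suc \<Rightarrow> bool" where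
  "a < b \<longleftrightarrow> (a, b) \<in> card_suc |UNIV :: 'a set| \<and> a \<noteq> b"

instance
proof -
  let ?r = "card_suc |UNIV :: 'a set|"
  have "well_order_on UNIV ?r"
    using card_order_card_suc[OF card_of_card_order_on[of "UNIV :: 'a set"]]
    by (simp add: card_order_on_def)
  then have lin: "linear_order_on UNIV ?r" and wf: "wf (?r - Id)"
    by (simp_all add: well_order_on_def)
  have r: "refl ?r" and t: "trans ?r" and a: "antisym ?r" and tot: "total ?r"
    using lin by (simp_all add: order_on_defs)
  have less: "{(x, y :: 'a suc). x < y} = ?r - Id"
    by (auto simp: less_suc_def)
  show "OFCLASS('a suc, wellorder_class)"
  proof (intro_classes)
    fix x y z :: "'a suc"
    show "x < y \<longleftrightarrow> x \<le> y \<and> \<not> y \<le> x"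
      unfolding less_suc_def less_eq_suc_def using a r by (auto simp: antisym_def refl_on_def)
    show "x \<le> x"
      unfolding less_eq_suc_def using r by (auto simp: refl_on_def)
    show "x \<le> z" if "x \<le> y" "y \<le> z"
      using that t unfolding less_eq_suc_def by (rule_tac transD)
    show "x = y" if "x \<le> y" "y \<le> x"
      using that a unfolding less_eq_suc_def by (rule_tac antisymD)
    show "x \<le> y \<or> y \<le> x"
      unfolding less_eq_suc_def using tot r unfolding total_on_def refl_on_def by (cases "x = y") auto
    show "P x" if "\<And>x. (\<And>y. y < x \<Longrightarrow> P y) \<Longrightarrow> P x" for P
      using wf_induct_rule[OF wf[folded less], of P x] that by auto
  qed
qed

end

type_synonym omega1 = "nat suc"
type_synonym omega2 = "omega1 suc"

definition ozero :: "'o::wellorder" where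
  "ozero = (LEAST a. True)"

text \<open>Only meaningful if \<^term>\<open>a\<close> is not the greatest element.\<close>

definition osucc :: "'o::wellorder \<Rightarrow> 'o" where
  "osucc a = (LEAST b. a < b)"

definition is_successor :: "'o::wellorder \<Rightarrow> bool" where
  "is_successor a \<longleftrightarrow> (\<exists>b<a. a = osucc b)"

definition opred :: "'o::wellorder \<Rightarrow> 'o" where
  "opred a = (THE b. b < a \<and> a = osucc b)"

definition is_limit :: "'o::wellorder \<Rightarrow> bool" where
  "is_limit a \<longleftrightarrow> a \<noteq> ozero \<and> \<not> is_successor a"

lemma ozero_le: "ozero \<le> (a :: 'o::wellorder)"
  unfolding ozero_def by (rule Least_le) simp

lemma opred_osucc:
  assumes "b < osucc b"
  shows "opred (osucc b) = b"
  unfolding opred_def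
proof (rule the_equality)
  show "b < osucc b \<and> osucc b = osucc b" using assms by simp
next
  fix c assume c: "c < osucc b \<and> osucc b = osucc c"
  have "\<not> b < c" using c Least_le[of "\<lambda>d. b < d" c] unfolding osucc_def by auto
  moreover have "\<not> c < b" using c assms Least_le[of "\<lambda>d. c < d" b] unfolding osucc_def by auto
  ultimately show "c = b" by simp
qed

lemma opred_less:
  assumes "is_successor a"
  shows "opred a < a"
  using assms opred_osucc unfolding is_successor_def by metis

lemma suc_less_osucc:
  fixes a :: "'a suc"
  assumes "infinite (UNIV :: 'a set)"
  shows "a < osucc a"
proof -
  let ?r = "card_suc |UNIV :: 'a set|"
  have card: "card_order |UNIV :: 'a set|"
    by (rule card_of_card_order_on)
  have "|UNIV :: 'a set| \<le>o |Field ?r|"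
    using card_suc_greater[OF card] card_of_Field_ordIso[OF Card_order_card_suc[OF card]]
      ordLess_imp_ordLeq ordIso_symmetric ordLeq_ordIso_trans by blast
  then have "infinite (Field ?r)"
    using assms card_of_ordLeq_infinite by blast
  then obtain b where "(a, b) \<in> ?r" "a \<noteq> b"
    using infinite_Card_order_limit[OF Card_order_card_suc[OF card], of a] Field_card_suc by blast
  then have "a < b" by (simp add: less_suc_def)
  then show ?thesis unfolding osucc_def by (rule LeastI)
qed

lemma infinite_UNIV_suc:
  assumes "infinite (UNIV :: 'a set)"
  shows "infinite (UNIV :: 'a suc set)"
proof
  assume fin: "finite (UNIV :: 'a suc set)"
  then have "Max (UNIV :: 'a suc set) < Max UNIV"
    using suc_less_osucc[OF assms, of "Max UNIV"] Max_ge[OF fin, of "osucc (Max UNIV)"] by auto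
  then show False by simp
qed

lemma omega1_less_osucc: "a < osucc (a :: omega1)"
  by (rule suc_less_osucc) simp

lemma omega2_less_osucc: "a < osucc (a :: omega2)"
  by (rule suc_less_osucc, rule infinite_UNIV_suc) simp

lemma card_of_omega1: "|UNIV :: omega1 set| =o cardSuc natLeq"
proof -
  have "cardSuc natLeq =o card_suc natLeq"
    by (rule cardSuc_ordIso_card_suc[OF natLeq_card_order])
  moreover have "|Field (card_suc natLeq)| =o card_suc natLeq"
    by (rule card_of_Field_ordIso[OF Card_order_card_suc[OF natLeq_card_order]])
  ultimately show ?thesis
    unfolding Field_card_suc by (metis ordIso_symmetric ordIso_transitive)
qed


section \<open>Topological notions\<close>

definition P_space :: "'a topology \<Rightarrow> bool" where
  "P_space X \<longleftrightarrow> (\<forall>S. gdelta_in X S \<longrightarrow> openin X S)"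

definition scattered_space :: "'a topology \<Rightarrow> bool" where
  "scattered_space X \<longleftrightarrow>
     (\<forall>S. S \<subseteq> topspace X \<and> S \<noteq> {} \<longrightarrow> (\<exists>x\<in>S. openin (subtopology X S) {x}))"

definition has_weight :: "'a topology \<Rightarrow> 'c rel \<Rightarrow> bool" where
  "has_weight X \<kappa> \<longleftrightarrow>
     (\<exists>\<B>. openin X = arbitrary union_of (\<lambda>U. U \<in> \<B>) \<and> |\<B>| =o \<kappa>) \<and>
     (\<forall>\<B>. openin X = arbitrary union_of (\<lambda>U. U \<in> \<B>) \<longrightarrow> \<kappa> \<le>o |\<B>| )"

definition embeds_in :: "'a topology \<Rightarrow> 'b topology \<Rightarrow> bool"  (infix \<open>\<subset>\<^sub>h\<close> 50) where
  "X \<subset>\<^sub>h Y \<longleftrightarrow> (\<exists>S \<subseteq> topspace Y. X homeomorphic_space subtopology Y S)"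

definition CB_derivative_set :: "'a topology \<Rightarrow> 'a set \<Rightarrow> 'a set" where
  "CB_derivative_set X A = {x \<in> A. \<not> openin (subtopology X A) {x}}"

function CB_derivative :: "'a topology \<Rightarrow> 'o::wellorder \<Rightarrow> 'a set" where
  "CB_derivative X a =
     (if a = ozero then topspace X
      else if is_successor a then CB_derivative_set X (CB_derivative X (opred a))
      else (\<Inter>b\<in>{..<a}. CB_derivative X b))"
  by auto
termination
  by (relation "inv_image {(a, b). a < b} snd") (auto intro: wf wf_inv_image opred_less)

declare CB_derivative.simps [simp del]

text \<open>\<open>has_CB_rank X \<nu>\<close> says that the ordinal \<open>N(X)\<close> exists in the well-order at hand and is \<open>\<nu>\<close>.\<close>

definition has_CB_rank :: "'a topology \<Rightarrow> 'o::wellorder \<Rightarrow> bool" where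
  "has_CB_rank X \<nu> \<longleftrightarrow> CB_derivative X \<nu> = {} \<and> (\<forall>b<\<nu>. CB_derivative X b \<noteq> {})"

text \<open>
  The sets of points removed at the successive stages below \<open>N(E)\<close> are non-empty and pairwise
  disjoint, so \<open>N(E)\<close> has cardinality at most that of the type of points.  Letting the
  ordinals below range over \<^typ>\<open>'a suc\<close> is therefore no restriction on \<open>N(E)\<close>.
\<close>

definition elementary_set :: "'a topology \<Rightarrow> 'a set \<Rightarrow> bool" where
  "elementary_set X E \<longleftrightarrow>
     regular_space X \<and> t1_space X \<and> P_space X \<and> scattered_space X \<and>
     openin X E \<and> closedin X E \<and>
     (\<exists>\<mu> :: 'a suc. \<mu> < osucc \<mu> \<and> has_CB_rank (subtopology X E) (osucc \<mu>) \<and>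
        (\<exists>x. CB_derivative (subtopology X E) \<mu> = {x}))"

definition P_base_at :: "'a topology \<Rightarrow> 'a \<Rightarrow> (omega1 \<Rightarrow> 'a set) \<Rightarrow> bool" where
  "P_base_at X x V \<longleftrightarrow>
     (\<forall>a. x \<in> V a) \<and>
     (\<forall>U. openin X U \<and> x \<in> U \<longrightarrow> (\<exists>a. V a \<subseteq> U)) \<and>
     V ozero = topspace X \<and>
     (\<forall>a. openin X (V a) \<and> closedin X (V a)) \<and>
     (\<forall>a b. b < a \<longrightarrow> V a \<subseteq> V b) \<and>
     (\<forall>a. is_limit a \<longrightarrow> V a = (\<Inter>b\<in>{..<a}. V b))"


section \<open>The spaces \<open>J(\<alpha>)\<close>\<close>

text \<open>
  The space \<open>J(\<alpha>)\<close> is determined only up to homeomorphism; \<open>is_J \<alpha> T\<close> says that \<open>T\<close> is a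
  copy of it.  The smaller spaces entering the construction of \<open>T\<close> are homeomorphic to
  subspaces of \<open>T\<close>, so it is no restriction that they live on the same type of points.
\<close>

inductive is_J :: "omega2 \<Rightarrow> 'b topology \<Rightarrow> bool" where
  zero: "is_J ozero T" if "topspace T = {}"
| one: "is_J (osucc ozero) T" if "topspace T = {x}"
| succ: "is_J (osucc \<beta>) T"
    if "\<beta> \<noteq> ozero" and "is_J \<beta> S"
      and "regular_space T" and "t1_space T" and "P_space T"
      and "CB_derivative T \<beta> = {x}" and "P_base_at T x V"
      and "\<forall>a :: omega1. subtopology T (V a - V (osucc a)) homeomorphic_space
             sum_topology (\<lambda>_ :: omega1. S) UNIV"
| limit: "is_J \<beta> T"
    if "is_limit \<beta>" and "\<forall>\<gamma><\<beta>. is_J \<gamma> (S \<gamma>)"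
      and "T homeomorphic_space sum_topology S {..<\<beta>}"

end

theory Submission
  imports Defs
begin

text \<open>
  For \<open>\<alpha> = 0\<close> both spaces are single points, so let \<open>\<alpha> > 0\<close>.
  The top point \<open>y\<close> of an elementary set \<open>Y\<close> of rank \<open>\<alpha> + 1\<close> is mapped to the top point of
  \<open>J(\<alpha> + 1)\<close>, and everything else is mapped slice by slice.  The weight hypothesis and the
  \<open>P\<close>-space property give \<open>y\<close> a \<open>P\<close>-base: the intersections of the initial segments of
  a clopen neighbourhood base indexed by \<open>\<omega>\<^sub>1\<close> (\<open>P_base_exists\<close>).  The slices of that base partition the
  other points of \<open>Y\<close> into clopen sets, just as the slices of the given \<open>P\<close>-base partition the other
  points of \<open>J(\<alpha> + 1)\<close>.  If every slice of \<open>Y\<close> embeds in the slice of \<open>J(\<alpha> + 1)\<close> with the same index,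
  then the union of these embeddings is an embedding, because the basic neighbourhoods of the two top
  points correspond to one another (\<open>embeds_in_slicewise\<close>).

  It remains to embed a slice \<open>Z\<close> of \<open>Y\<close> in a sum of \<open>\<omega>\<^sub>1\<close> copies of \<open>J(\<alpha>)\<close>.  Every point of \<open>Z\<close> has some
  rank \<open>\<beta> < \<alpha>\<close> and hence a clopen neighbourhood of which it is the only point of rank at least \<open>\<beta>\<close>
  (\<open>clopen_neighbourhood_of_rank\<close>).  By induction on \<open>\<alpha>\<close> such a neighbourhood embeds in
  \<open>J(\<beta> + 1)\<close>, which embeds in \<open>J(\<alpha>)\<close> (\<open>is_J_contains_smaller\<close>).  Since \<open>Z\<close> has a base of size at most
  \<open>\<omega>\<^sub>1\<close>, it is covered by \<open>\<omega>\<^sub>1\<close> of these neighbourhoods.  Removing from each one the union of its countably many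
  predecessors makes them disjoint and keeps them open, as \<open>Z\<close> is a \<open>P\<close>-space (\<open>clopen_partition\<close>).
  The pieces need not be elementary any more, but they still embed in \<open>J(\<alpha>)\<close>, and that is enough for
  \<open>Z\<close> to embed in the sum.

  One point of bookkeeping is left: that the last non-empty derivative of \<open>Y\<close> is a singleton is known for derivatives
  indexed by the ordinals of one type, whereas \<open>\<alpha>\<close> belongs to another.  The last non-empty
  derivative does not depend on the type that supplies the indices (\<open>last_CB_derivative_unique\<close>).
\<close>

section \<open>Ordinals\<close>

lemma osucc_leI:
  fixes a b :: "'o::wellorder"
  assumes "a < b"
  shows "osucc a \<le> b"
  using assms unfolding osucc_def by (rule Least_le)

lemma less_osucc:
  fixes a b :: "'o::wellorder"
  assumes "a < b"
  shows "a < osucc a"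
  using assms unfolding osucc_def by (rule LeastI)

lemma not_successor_ozero: "\<not> is_successor (ozero :: 'o::wellorder)"
  using ozero_le unfolding is_successor_def by (metis leD)

lemma osucc_less_limit:
  fixes a l :: "'o::wellorder"
  assumes "is_limit l" "a < l"
  shows "osucc a < l"
  using assms osucc_leI[OF assms(2)] unfolding is_limit_def is_successor_def
  by (metis order_le_less)

lemma ozero_less_limit:
  fixes l :: "'o::wellorder"
  assumes "is_limit l"
  shows "ozero < l"
  using assms ozero_le[of l] unfolding is_limit_def by (metis order_le_less)

lemma ordinal_cases [case_names zero succ limit]:
  fixes a :: "'o::wellorder"
  obtains "a = ozero" | b where "b < a" "a = osucc b" | "is_limit a"
  unfolding is_limit_def is_successor_def by blast

text \<open>
  A point can drop out of a family of sets that is continuous at limits only at a successor step.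
  Applied to the derivatives of a space this yields the rank of a point, applied to a \<open>P\<close>-base it
  yields the slice that contains a point.
\<close>

lemma last_stage:
  fixes F :: "'o::wellorder \<Rightarrow> 'a set"
  assumes "x \<in> F ozero" "x \<notin> F a"
    and lim: "\<And>l. is_limit l \<Longrightarrow> (\<Inter>b\<in>{..<l}. F b) \<subseteq> F l"
  obtains b where "b < a" "x \<in> F b" "x \<notin> F (osucc b)"
proof -
  define c where "c = (LEAST c. x \<notin> F c)"
  have c: "x \<notin> F c" "c \<le> a" 
    unfolding c_def using assms(2) LeastI[of "\<lambda>c. x \<notin> F c" a] Least_le[of "\<lambda>c. x \<notin> F c" a] by auto
  have below: "x \<in> F b" if "b < c" for b
    using that not_less_Least unfolding c_def by blast
  show ?thesis
  proof (cases c rule: ordinal_cases)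
    case zero then show ?thesis using c assms(1) by simp
  next
    case (succ b) then show ?thesis using c below that[of b] by auto
  next
    case limit then show ?thesis using lim[OF limit] below c by auto
  qed
qed

lemma osucc_inject_omega2:
  fixes a b :: omega2
  assumes "osucc a = osucc b"
  shows "a = b"
  using assms opred_osucc omega2_less_osucc by metis

lemma countable_below_omega1: "countable {..<(a :: omega1)}"
proof -
  let ?r = "card_suc |UNIV :: nat set|"
  have co: "card_order |UNIV :: nat set|" by (rule card_of_card_order_on)
  have "|underS ?r a| <o ?r"
    by (rule card_of_underS[OF Card_order_card_suc[OF co]]) (simp add: Field_card_suc)
  then have "|underS ?r a| \<le>o |UNIV :: nat set|"
    by (rule card_suc_ordLess_imp_ordLeq[OF card_of_Card_order card_of_Card_order co])
  moreover have "underS ?r a = {..<a}"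
    unfolding underS_def by (auto simp: less_suc_def)
  ultimately show ?thesis
    unfolding countable_def card_of_ordLeq[symmetric] by auto
qed

section \<open>Cantor-Bendixson derivatives\<close>

lemma CB_derivative_ozero: "CB_derivative X ozero = topspace X"
  by (simp add: CB_derivative.simps)

lemma CB_derivative_osucc:
  fixes b :: "'o::wellorder"
  assumes "b < osucc b"
  shows "CB_derivative X (osucc b) = CB_derivative_set X (CB_derivative X b)"
proof -
  have "is_successor (osucc b)" using assms unfolding is_successor_def by blast
  then show ?thesis
    using not_successor_ozero by (subst CB_derivative.simps) (auto simp: opred_osucc[OF assms])
qed

lemma CB_derivative_limit:
  fixes l :: "'o::wellorder"
  assumes "is_limit l"
  shows "CB_derivative X l = (\<Inter>b\<in>{..<l}. CB_derivative X b)"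
  using assms by (subst CB_derivative.simps) (simp add: is_limit_def)

lemma CB_derivative_antimono:
  fixes a b :: "'o::wellorder"
  assumes "a \<le> b"
  shows "CB_derivative X b \<subseteq> CB_derivative X a"
  using assms
proof (induction b rule: less_induct)
  case (less b)
  show ?case
  proof (cases "a = b")
    case False
    then have ab: "a < b" using less.prems by simp
    show ?thesis
    proof (cases b rule: ordinal_cases)
      case zero then show ?thesis using ab ozero_le[of a] by simp
    next
      case (succ c)
      then have "a \<le> c" using ab osucc_leI[of c a] by (metis leD leI)
      then show ?thesis
        using less.IH[OF succ(1)] succ CB_derivative_osucc[of c X]
        unfolding CB_derivative_set_def by auto
    next
      case limit
      show ?thesis unfolding CB_derivative_limit[OF limit] using ab by (intro INF_lower) simp
    qed
  qed simp
qed

lemma CB_derivative_subset_topspace: "CB_derivative X a \<subseteq> topspace X"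
  using CB_derivative_antimono[OF ozero_le] CB_derivative_ozero by metis

text \<open>
  Being isolated in a set is a local matter, so derivation commutes with passing to an open
  subspace.
\<close>

lemma CB_derivative_open_subspace:
  fixes a :: "'o::wellorder"
  assumes "openin X U"
  shows "CB_derivative (subtopology X U) a = U \<inter> CB_derivative X a"
proof (induction a rule: less_induct)
  case (less a)
  show ?case
  proof (cases a rule: ordinal_cases)
    case zero then show ?thesis by (auto simp: CB_derivative_ozero)
  next
    case (succ b)
    let ?A = "CB_derivative X b"
    have iso: "openin (subtopology X (U \<inter> ?A)) {x} \<longleftrightarrow> openin (subtopology X ?A) {x}"
      if "x \<in> U \<inter> ?A" for x
    proof
      assume "openin (subtopology X (U \<inter> ?A)) {x}"
      then obtain W where "openin X W" "{x} = W \<inter> (U \<inter> ?A)"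
        by (auto simp: openin_subtopology)
      then show "openin (subtopology X ?A) {x}"
        using assms by (auto simp: openin_subtopology intro!: exI[of _ "W \<inter> U"])
    next
      assume "openin (subtopology X ?A) {x}"
      then obtain W where "openin X W" "{x} = W \<inter> ?A"
        by (auto simp: openin_subtopology)
      then show "openin (subtopology X (U \<inter> ?A)) {x}"
        using that by (auto simp: openin_subtopology intro!: exI[of _ W])
    qed
    have b: "b < osucc b" using succ by simp
    have "subtopology (subtopology X U) (U \<inter> ?A) = subtopology X (U \<inter> ?A)"
      by (simp add: subtopology_subtopology Int_absorb1)
    then have "CB_derivative (subtopology X U) a
        = {x \<in> U \<inter> ?A. \<not> openin (subtopology X (U \<inter> ?A)) {x}}"
      unfolding succ(2) CB_derivative_osucc[OF b] CB_derivative_set_def less.IH[OF succ(1)] by simp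
    also have "\<dots> = U \<inter> {x \<in> ?A. \<not> openin (subtopology X ?A) {x}}"
      using iso by blast
    finally show ?thesis
      unfolding succ(2) CB_derivative_osucc[OF b] CB_derivative_set_def .
  next
    case limit
    have "{..<a} \<noteq> {}" using ozero_less_limit[OF limit] by blast
    then have "(\<Inter>b\<in>{..<a}. U \<inter> CB_derivative X b) = U \<inter> (\<Inter>b\<in>{..<a}. CB_derivative X b)"
      by blast
    then show ?thesis
      using less.IH unfolding CB_derivative_limit[OF limit] by simp
  qed
qed

text \<open>
  Both transfinite sequences of derivatives start with the whole space and are generated by the same two operations,
  derivation and intersection.  The second one reaches the empty set, so it has been through
  everything that these operations can produce.
\<close>

lemma CB_derivative_transfer:
  fixes a :: "'o::wellorder" and \<nu> :: "'p::wellorder"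
  assumes empty: "CB_derivative X \<nu> = {}"
  obtains b where "b \<le> \<nu>" "CB_derivative X a = CB_derivative X b"
proof -
  have "\<exists>b\<le>\<nu>. CB_derivative X a = CB_derivative X b"
  proof (induction a rule: less_induct)
    case (less a)
    show ?case
    proof (cases a rule: ordinal_cases)
      case zero
      then show ?thesis using ozero_le[of \<nu>] by (metis CB_derivative_ozero)
    next
      case (succ c)
      then obtain b where b: "b \<le> \<nu>" "CB_derivative X c = CB_derivative X b"
        using less.IH by blast
      have a: "CB_derivative X a = CB_derivative_set X (CB_derivative X b)"
        using succ b CB_derivative_osucc[of c X] by simp
      show ?thesis
      proof (cases "b < \<nu>")
        case True
        then show ?thesis
          using a CB_derivative_osucc[OF less_osucc[OF True], of X] osucc_leI[OF True] by metis
      next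
        case False
        then show ?thesis using a b empty by (auto simp: CB_derivative_set_def)
      qed
    next
      case limit
      have "\<forall>c\<in>{..<a}. \<exists>b\<le>\<nu>. CB_derivative X c = CB_derivative X b" using less.IH by blast
      then obtain h where h: "\<And>c. c < a \<Longrightarrow> h c \<le> \<nu> \<and> CB_derivative X c = CB_derivative X (h c)"
        by (metis lessThan_iff)
      \<comment> \<open>The intersection is the derivative at the supremum of the indices \<open>h c\<close>.\<close>
      define s where "s = (LEAST s. \<forall>c<a. h c \<le> s)"
      have ub: "\<forall>c<a. h c \<le> s" unfolding s_def by (rule LeastI[of _ \<nu>]) (use h in blast)
      have s_least: "s \<le> t" if "\<forall>c<a. h c \<le> t" for t
        unfolding s_def using that by (rule Least_le)
      have s_le: "s \<le> \<nu>" using s_least h by blast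
      have below_s: "\<exists>c<a. t < h c" if "t < s" for t
        using s_least[of t] that by (meson leD leI)
      have "CB_derivative X a = (\<Inter>c\<in>{..<a}. CB_derivative X (h c))"
        using h by (auto simp: CB_derivative_limit[OF limit])
      also have "\<dots> = CB_derivative X s"
      proof
        show "CB_derivative X s \<subseteq> (\<Inter>c\<in>{..<a}. CB_derivative X (h c))"
          using ub by (intro INT_greatest CB_derivative_antimono) simp
        have attained: "(\<Inter>c\<in>{..<a}. CB_derivative X (h c)) \<subseteq> CB_derivative X s" if "c < a" "h c = s" for c
          using that by (intro INF_lower2[of c]) auto
        show "(\<Inter>c\<in>{..<a}. CB_derivative X (h c)) \<subseteq> CB_derivative X s"
        proof (cases s rule: ordinal_cases)
          case zero
          then have "h ozero = s"
            using ub ozero_less_limit[OF limit] ozero_le[of "h ozero"] by (auto intro: antisym)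
          then show ?thesis by (rule attained[OF ozero_less_limit[OF limit]])
        next
          case (succ t)
          then obtain c where c: "c < a" "t < h c" using below_s by blast
          then have "h c = s"
            using succ(2) ub osucc_leI[OF c(2)] by (auto intro: antisym)
          then show ?thesis by (rule attained[OF c(1)])
        next
          case slim: limit
          have "(\<Inter>c\<in>{..<a}. CB_derivative X (h c)) \<subseteq> CB_derivative X t" if t: "t < s" for t
          proof -
            obtain c where "c < a" "t < h c" using below_s[OF t] by blast
            then show ?thesis
              using CB_derivative_antimono[of t "h c" X] by (intro INF_lower2[of c]) simp_all
          qed
          then show ?thesis unfolding CB_derivative_limit[OF slim] by (intro INF_greatest) simp
        qed
      qed
      finally show ?thesis using s_le by blast
    qed
  qed
  then show ?thesis using that by blast
qed

lemma last_CB_derivative_mono: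
  fixes a :: "'o::wellorder" and b :: "'p::wellorder"
  assumes a: "has_CB_rank X (osucc a)" "a < osucc a" and b: "has_CB_rank X (osucc b)"
  shows "CB_derivative X b \<subseteq> CB_derivative X a"
proof -
  have b0: "CB_derivative X (osucc b) = {}" using b unfolding has_CB_rank_def by blast
  obtain e where e: "e \<le> osucc b" "CB_derivative X a = CB_derivative X e"
    by (rule CB_derivative_transfer[OF b0, of a])
  have "CB_derivative X a \<noteq> {}" using a unfolding has_CB_rank_def by blast
  then have "e \<noteq> osucc b" using e b0 by auto
  then have "e \<le> b" using e osucc_leI[of b e] by (metis leI order_antisym)
  then show ?thesis unfolding e(2) by (rule CB_derivative_antimono)
qed

lemma last_CB_derivative_unique:
  fixes a :: "'o::wellorder" and b :: "'p::wellorder"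
  assumes "has_CB_rank X (osucc a)" "a < osucc a"
    and "has_CB_rank X (osucc b)" "b < osucc b"
  shows "CB_derivative X a = CB_derivative X b"
  using last_CB_derivative_mono[OF assms(1,2,3)] last_CB_derivative_mono[OF assms(3,4,1)] by blast

section \<open>Embeddings\<close>

lemma embedding_map_image_subset:
  assumes "embedding_map X Y f"
  shows "f ` topspace X \<subseteq> topspace Y"
proof -
  have "f ` topspace X = topspace Y \<inter> f ` topspace X"
    using homeomorphic_imp_surjective_map[OF assms[unfolded embedding_map_def]]
    unfolding topspace_subtopology .
  then show ?thesis unfolding inf.absorb_iff2 by (rule sym)
qed

lemma embeds_in_iff_embedding_map: "X \<subset>\<^sub>h Y \<longleftrightarrow> (\<exists>f. embedding_map X Y f)"
proof
  assume "X \<subset>\<^sub>h Y"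
  then obtain S f where S: "S \<subseteq> topspace Y" and f: "homeomorphic_map X (subtopology Y S) f"
    unfolding embeds_in_def homeomorphic_space by blast
  have "f ` topspace X = S"
    using homeomorphic_imp_surjective_map[OF f] S by auto
  then show "\<exists>f. embedding_map X Y f" using f unfolding embedding_map_def by blast
next
  assume "\<exists>f. embedding_map X Y f"
  then obtain f where f: "embedding_map X Y f" by blast
  show "X \<subset>\<^sub>h Y"
    using embedding_map_image_subset[OF f] f
    unfolding embeds_in_def homeomorphic_space embedding_map_def by blast
qed

lemma embeds_in_trans: "X \<subset>\<^sub>h Y \<Longrightarrow> Y \<subset>\<^sub>h Z \<Longrightarrow> X \<subset>\<^sub>h Z"
  unfolding embeds_in_iff_embedding_map using embedding_map_compose by blast

lemma embeds_in_refl: "X \<subset>\<^sub>h X"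
  unfolding embeds_in_def by (rule exI[of _ "topspace X"]) (simp add: homeomorphic_space_refl)

lemma subtopology_embeds_in: "subtopology X S \<subset>\<^sub>h X"
proof -
  have "subtopology X S = subtopology X (topspace X \<inter> S)" by (simp add: subtopology_restrict)
  then show ?thesis
    unfolding embeds_in_def
    by (intro exI[of _ "topspace X \<inter> S"]) (simp add: homeomorphic_space_refl)
qed

lemma homeomorphic_space_imp_embeds_in: "X homeomorphic_space Y \<Longrightarrow> X \<subset>\<^sub>h Y"
  unfolding embeds_in_def by (rule exI[of _ "topspace Y"]) simp

lemma sum_component_embeds_in:
  assumes "i \<in> I"
  shows "S i \<subset>\<^sub>h sum_topology S I"
  unfolding embeds_in_iff_embedding_map using embedding_map_component_injection[OF assms] by blast

lemma embedding_mapI_pointwise: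
  assumes inj: "inj_on f (topspace X)"
    and img: "\<And>z. z \<in> topspace X \<Longrightarrow> f z \<in> topspace Y"
    and cont: "\<And>z W. z \<in> topspace X \<Longrightarrow> openin Y W \<Longrightarrow> f z \<in> W \<Longrightarrow>
      \<exists>U. openin X U \<and> z \<in> U \<and> f ` U \<subseteq> W"
    and opn: "\<And>z U. z \<in> U \<Longrightarrow> openin X U \<Longrightarrow>
      \<exists>W. openin Y W \<and> f z \<in> W \<and> (\<forall>u\<in>topspace X. f u \<in> W \<longrightarrow> u \<in> U)"
  shows "embedding_map X Y f"
  unfolding embedding_map_def
proof (rule bijective_open_imp_homeomorphic_map)
  have "continuous_map X Y f"
    unfolding continuous_map_def
  proof (intro conjI allI impI)
    show "f \<in> topspace X \<rightarrow> topspace Y" using img by blast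
    fix W assume W: "openin Y W"
    show "openin X {z \<in> topspace X. f z \<in> W}"
    proof (subst openin_subopen, intro ballI)
      fix z assume "z \<in> {z \<in> topspace X. f z \<in> W}"
      then obtain U where U: "openin X U" "z \<in> U" "f ` U \<subseteq> W" using cont W by blast
      then have "U \<subseteq> {z \<in> topspace X. f z \<in> W}" using openin_subset[OF U(1)] by blast
      then show "\<exists>U. openin X U \<and> z \<in> U \<and> U \<subseteq> {z \<in> topspace X. f z \<in> W}"
        using U by blast
    qed
  qed
  then show "continuous_map X (subtopology Y (f ` topspace X)) f"
    by (simp add: continuous_map_in_subtopology)
  show "open_map X (subtopology Y (f ` topspace X)) f"
    unfolding open_map_def
  proof (intro allI impI)
    fix U assume U: "openin X U"
    define W where "W = \<Union>{W. openin Y W \<and> (\<forall>u\<in>topspace X. f u \<in> W \<longrightarrow> u \<in> U)}"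
    have "openin Y W" unfolding W_def by (rule openin_Union) blast
    moreover have "f ` U = W \<inter> f ` topspace X"
    proof
      show "f ` U \<subseteq> W \<inter> f ` topspace X"
      proof (rule image_subsetI)
        fix z assume z: "z \<in> U"
        then have "f z \<in> W" using opn[OF z U] unfolding W_def by blast
        then show "f z \<in> W \<inter> f ` topspace X" using z openin_subset[OF U] by blast
      qed
      show "W \<inter> f ` topspace X \<subseteq> f ` U"
        unfolding W_def by blast
    qed
    ultimately show "openin (subtopology Y (f ` topspace X)) (f ` U)"
      unfolding openin_subtopology by blast
  qed
  show "f ` topspace X = topspace (subtopology Y (f ` topspace X))"
    using img by auto
qed (rule inj)

text \<open>
  At a point of one of the open sets \<open>D a\<close>, being an embedding is a local question: \<open>f\<close> maps no
  other point into \<open>W a\<close>, so that \<open>W a\<close> separates the image of \<open>D a\<close> from the rest of the image.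
  Only the exceptional points in \<open>P\<close> have to be examined by hand.
\<close>

lemma embedding_map_from_pieces:
  fixes D :: "'i \<Rightarrow> 'a set"
  assumes openD: "\<And>a. openin X (D a)" and openW: "\<And>a. openin Y (W a)"
    and disjW: "\<And>a b. a \<noteq> b \<Longrightarrow> W a \<inter> W b = {}"
    and emb: "\<And>a. embedding_map (subtopology X (D a)) Y f"
    and img: "\<And>a. f ` D a \<subseteq> W a"
    and P: "P = topspace X - (\<Union>a. D a)"
    and injP: "inj_on f P" and imgP: "f ` P \<subseteq> topspace Y - (\<Union>a. W a)"
    and contP: "\<And>z W. z \<in> P \<Longrightarrow> openin Y W \<Longrightarrow> f z \<in> W \<Longrightarrow>
      \<exists>U. openin X U \<and> z \<in> U \<and> f ` U \<subseteq> W"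
    and opnP: "\<And>z U. z \<in> P \<Longrightarrow> z \<in> U \<Longrightarrow> openin X U \<Longrightarrow>
      \<exists>W. openin Y W \<and> f z \<in> W \<and> (\<forall>u\<in>topspace X. f u \<in> W \<longrightarrow> u \<in> U)"
  shows "embedding_map X Y f"
proof -
  have hom: "homeomorphic_map (subtopology X (D a)) (subtopology Y (f ` D a)) f" for a
    using emb[of a] openin_subset[OF openD[of a]] unfolding embedding_map_def
    by (simp add: Int_absorb1)
  have injD: "inj_on f (D a)" for a
    using homeomorphic_imp_injective_map[OF hom[of a]] openin_subset[OF openD[of a]]
    by (simp add: Int_absorb1)
  have mem: "u \<in> D a" if u: "u \<in> topspace X" "f u \<in> W a" for u a
  proof -
    have "u \<notin> P" using u imgP by blast
    then obtain b where b: "u \<in> D b" using u P by blast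
    then have "f u \<in> W b" using img by blast
    then have "a = b" using disjW[of a b] u by blast
    then show ?thesis using b by simp
  qed
  have WY: "W a \<subseteq> topspace Y" for a using openin_subset[OF openW] .
  have cases: thesis if "u \<in> topspace X" "u \<in> P \<Longrightarrow> thesis" "\<And>a. u \<in> D a \<Longrightarrow> f u \<in> W a \<Longrightarrow> thesis" for u thesis
    using that P img by blast
  show ?thesis
  proof (rule embedding_mapI_pointwise)
    show "inj_on f (topspace X)"
    proof (rule inj_onI)
      fix u v assume uv: "u \<in> topspace X" "v \<in> topspace X" "f u = f v"
      show "u = v"
      proof (rule cases[OF uv(1)])
        assume u: "u \<in> P"
        then have fv: "f v \<notin> W a" for a using uv(3) imgP by auto
        have "v \<in> P" by (rule cases[OF uv(2)]) (use fv in blast)+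
        then show ?thesis using u uv injP by (simp add: inj_onD)
      next
        fix a assume a: "u \<in> D a" "f u \<in> W a"
        then have "v \<in> D a" using mem uv by simp
        then show ?thesis using a uv injD[of a] by (simp add: inj_onD)
      qed
    qed
    show "f z \<in> topspace Y" if "z \<in> topspace X" for z
      by (rule cases[OF that]) (use imgP WY in blast)+
    show "\<exists>U. openin X U \<and> z \<in> U \<and> f ` U \<subseteq> O'" if z: "z \<in> topspace X" "openin Y O'" "f z \<in> O'" for z O'
    proof (rule cases[OF z(1)])
      fix a assume a: "z \<in> D a"
      let ?U = "{u \<in> topspace (subtopology X (D a)). f u \<in> O' \<inter> f ` D a}"
      have "openin (subtopology X (D a)) ?U"
        using homeomorphic_imp_continuous_map[OF hom[of a]] z(2)
        by (rule openin_continuous_map_preimage[OF _ openin_subtopology_Int])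
      then have "openin X ?U" using openin_trans_full openD by blast
      moreover have "z \<in> ?U" using a z by auto
      ultimately show ?thesis by (intro exI[of _ ?U]) auto
    qed (use contP z in blast)
    show "\<exists>O'. openin Y O' \<and> f z \<in> O' \<and> (\<forall>u\<in>topspace X. f u \<in> O' \<longrightarrow> u \<in> U)"
      if z: "z \<in> U" "openin X U" for z U
    proof -
      have zX: "z \<in> topspace X" using z openin_subset by blast
      show ?thesis
      proof (rule cases[OF zX])
        fix a assume a: "z \<in> D a" "f z \<in> W a"
        have "openin (subtopology X (D a)) (U \<inter> D a)"
          using z(2) by (rule openin_subtopology_Int)
        then have "openin (subtopology Y (f ` D a)) (f ` (U \<inter> D a))"
          using homeomorphic_imp_open_map[OF hom[of a]] unfolding open_map_def by blast
        then obtain O' where O': "openin Y O'" "f ` (U \<inter> D a) = O' \<inter> f ` D a"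
          unfolding openin_subtopology by blast
        have "u \<in> U" if u: "u \<in> topspace X" "f u \<in> O' \<inter> W a" for u
        proof -
          have "u \<in> D a" using u mem by blast
          then have "f u \<in> f ` (U \<inter> D a)" using O' u by blast
          then obtain v where v: "v \<in> U" "v \<in> D a" "f u = f v" by blast
          then have "u = v" using injD[of a] \<open>u \<in> D a\<close> by (simp add: inj_onD)
          then show ?thesis using v by simp
        qed
        moreover have "f z \<in> O'" using O'(2) z a by blast
        ultimately show ?thesis
          using a openin_Int[OF O'(1) openW[of a]] by (intro exI[of _ "O' \<inter> W a"]) blast
      qed (use opnP z in blast)
    qed
  qed
qed

lemma embeds_in_sum_of_copies:
  fixes D :: "'i \<Rightarrow> 'a set"
  assumes openD: "\<And>a. openin X (D a)" and disjD: "\<And>a b. a \<noteq> b \<Longrightarrow> D a \<inter> D b = {}"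
    and cover: "(\<Union>a. D a) = topspace X"
    and emb: "\<And>a. subtopology X (D a) \<subset>\<^sub>h S"
  shows "X \<subset>\<^sub>h sum_topology (\<lambda>_ :: 'i. S) UNIV"
proof -
  let ?T = "sum_topology (\<lambda>_ :: 'i. S) UNIV"
  obtain g where g: "\<And>a. embedding_map (subtopology X (D a)) S (g a)"
    using emb unfolding embeds_in_iff_embedding_map by metis
  define idx where "idx z = (THE a. z \<in> D a)" for z
  define f where "f z = (idx z, g (idx z) z)" for z
  have idx: "idx z = a" if "z \<in> D a" for z a
    unfolding idx_def using that disjD by (intro the_equality) auto
  have DX: "D a \<subseteq> topspace X" for a using openin_subset[OF openD] .
  have embf: "embedding_map (subtopology X (D a)) ?T f" for a
  proof (rule embedding_map_eq)
    show "embedding_map (subtopology X (D a)) ?T ((\<lambda>x. (a, x)) \<circ> g a)"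
      by (rule embedding_map_compose[OF g])
        (rule embedding_map_component_injection[of a UNIV "\<lambda>_. S", simplified])
    show "((\<lambda>x. (a, x)) \<circ> g a) z = f z" if "z \<in> topspace (subtopology X (D a))" for z
      using that idx[of z a] by (simp add: f_def)
  qed
  have gS: "g a ` D a \<subseteq> topspace S" for a
    using embedding_map_image_subset[OF g[of a]] DX[of a] by (simp add: Int_absorb1)
  have "embedding_map X ?T f"
  proof (rule embedding_map_from_pieces[where D = D and W = "\<lambda>a. {a} \<times> topspace S" and P = "{}"])
    show "openin ?T ({a} \<times> topspace S)" for a
    proof -
      have "openin S {x. i = a \<and> x \<in> topspace S}" for i by (cases "i = a") simp_all
      then show ?thesis by (auto simp: openin_sum_topology)
    qed
    show "f ` D a \<subseteq> {a} \<times> topspace S" for a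
      using idx[of _ a] gS[of a] by (auto simp: f_def)
  qed (use openD cover embf in auto)
  then show ?thesis unfolding embeds_in_iff_embedding_map by blast
qed

section \<open>P-spaces of weight at most the first uncountable cardinal\<close>

lemma P_space_countable_Inter:
  assumes "P_space X" "countable I" "I \<noteq> {}" "\<And>i. i \<in> I \<Longrightarrow> openin X (U i)"
  shows "openin X (\<Inter>i\<in>I. U i)"
proof -
  have "gdelta_in X (\<Inter>(U ` I))"
    using assms(2-4) by (intro gdelta_in_Inter) (auto intro: open_imp_gdelta_in)
  then show ?thesis using assms(1) unfolding P_space_def by blast
qed

lemma P_space_countable_Union_closed:
  assumes "P_space X" "countable I" "\<And>i. i \<in> I \<Longrightarrow> closedin X (C i)"
  shows "closedin X (\<Union>i\<in>I. C i)"
proof (cases "I = {}")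
  case False
  have "openin X (\<Inter>i\<in>I. topspace X - C i)"
    using assms False by (intro P_space_countable_Inter) auto
  moreover have "(\<Inter>i\<in>I. topspace X - C i) = topspace X - (\<Union>i\<in>I. C i)"
    using False by blast
  moreover have "(\<Union>i\<in>I. C i) \<subseteq> topspace X"
    using assms(3) closedin_subset by blast
  ultimately show ?thesis unfolding closedin_def by simp
qed simp

lemma P_space_subtopology:
  assumes "P_space X"
  shows "P_space (subtopology X S)"
  using assms unfolding P_space_def gdelta_in_subtopology openin_subtopology by blast

text \<open>
  Regularity gives a decreasing sequence of open neighbourhoods with closed sets squeezed in between.
  The intersection of the sequence is closed, and in a \<open>P\<close>-space it is also open.
\<close>

lemma regular_P_space_clopen_neighbourhood:
  assumes reg: "regular_space X" and P: "P_space X" and U: "openin X U" "x \<in> U"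
  obtains C where "openin X C" "closedin X C" "x \<in> C" "C \<subseteq> U"
proof -
  have shrink: "\<exists>V F. openin X V \<and> closedin X F \<and> x \<in> V \<and> V \<subseteq> F \<and> F \<subseteq> W"
    if "openin X W" "x \<in> W" for W
    using reg that unfolding neighbourhood_base_of_closedin[symmetric] neighbourhood_base_of by blast
  have "\<exists>V :: nat \<Rightarrow> 'a set. \<forall>n. (openin X (V n) \<and> x \<in> V n \<and> V n \<subseteq> U)
      \<and> (\<exists>F. closedin X F \<and> V (Suc n) \<subseteq> F \<and> F \<subseteq> V n)"
  proof (rule dependent_nat_choice)
    show "\<exists>V. openin X V \<and> x \<in> V \<and> V \<subseteq> U" using U by blast
  next
    fix V :: "'a set" and n :: nat
    assume V: "openin X V \<and> x \<in> V \<and> V \<subseteq> U"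
    obtain W F where WF: "openin X W" "closedin X F" "x \<in> W" "W \<subseteq> F" "F \<subseteq> V"
      using shrink[of V] V by auto
    have "W \<subseteq> U" using WF(4,5) V by blast
    then show "\<exists>W. (openin X W \<and> x \<in> W \<and> W \<subseteq> U) \<and> (\<exists>F. closedin X F \<and> W \<subseteq> F \<and> F \<subseteq> V)"
      using WF by (intro exI[of _ W] conjI exI[of _ F])
  qed
  then obtain V F where V: "\<And>n. openin X (V n) \<and> x \<in> V n \<and> V n \<subseteq> U"
    and F: "\<And>n::nat. closedin X (F n) \<and> V (Suc n) \<subseteq> F n \<and> F n \<subseteq> V n"
    by metis
  have eq: "(\<Inter>n. V n) = (\<Inter>n. F n)"
  proof
    show "(\<Inter>n. V n) \<subseteq> (\<Inter>n. F n)" using F by blast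
    show "(\<Inter>n. F n) \<subseteq> (\<Inter>n. V n)" using F by blast
  qed
  show ?thesis
  proof (rule that)
    show "openin X (\<Inter>n. V n)" using V by (intro P_space_countable_Inter[OF P]) auto
    show "closedin X (\<Inter>n. V n)" unfolding eq using F by (intro closedin_Inter) auto
    show "x \<in> (\<Inter>n. V n)" using V by simp
    show "(\<Inter>n. V n) \<subseteq> U" using V by blast
  qed
qed

text \<open>
  Weight at most \<open>\<omega>\<^sub>1\<close>.  The base is an indexed family with repetitions allowed, because the constructions below
  run along the well-order of its indices.
\<close>

definition has_omega1_base :: "'a topology \<Rightarrow> bool" where
  "has_omega1_base X \<longleftrightarrow> (\<exists>B :: omega1 \<Rightarrow> 'a set. (\<forall>a. openin X (B a)) \<and>
     (\<forall>U x. openin X U \<and> x \<in> U \<longrightarrow> (\<exists>a. x \<in> B a \<and> B a \<subseteq> U)))"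

lemma has_omega1_baseI:
  fixes B :: "omega1 \<Rightarrow> 'a set"
  assumes "\<And>a. openin X (B a)"
    and "\<And>U x. openin X U \<Longrightarrow> x \<in> U \<Longrightarrow> \<exists>a. x \<in> B a \<and> B a \<subseteq> U"
  shows "has_omega1_base X"
  unfolding has_omega1_base_def using assms by (intro exI[of _ B]) simp

lemma has_omega1_baseE:
  assumes "has_omega1_base X"
  obtains B :: "omega1 \<Rightarrow> 'a set" where "\<forall>a. openin X (B a)"
    "\<forall>U x. openin X U \<longrightarrow> x \<in> U \<longrightarrow> (\<exists>a. x \<in> B a \<and> B a \<subseteq> U)"
proof -
  obtain B :: "omega1 \<Rightarrow> 'a set" where "(\<forall>a. openin X (B a)) \<and>
      (\<forall>U x. openin X U \<and> x \<in> U \<longrightarrow> (\<exists>a. x \<in> B a \<and> B a \<subseteq> U))"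
    using assms unfolding has_omega1_base_def ..
  then show ?thesis by (intro that[of B]) simp_all
qed

lemma has_weight_imp_has_omega1_base:
  assumes "has_weight X (cardSuc natLeq)"
  shows "has_omega1_base X"
proof -
  obtain \<B> where B: "openin X = arbitrary union_of (\<lambda>U. U \<in> \<B>)" "|\<B>| =o cardSuc natLeq"
    using assms unfolding has_weight_def by blast
  have iso: "|\<B>| =o |UNIV :: omega1 set|"
    using B(2) card_of_omega1 ordIso_symmetric ordIso_transitive by blast
  have "\<B> \<noteq> {}" using iso card_of_empty2 ordIso_symmetric by blast
  moreover have "|\<B>| \<le>o |UNIV :: omega1 set|" using iso ordIso_iff_ordLeq by blast
  ultimately obtain b :: "omega1 \<Rightarrow> 'a set" where b: "range b = \<B>"
    using card_of_ordLeq2[of \<B> "UNIV :: omega1 set"] by blast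
  have "openin X (b a)" for a
    unfolding B(1) using b by (intro arbitrary_union_of_inc) blast
  moreover have "\<exists>a. x \<in> b a \<and> b a \<subseteq> U" if U: "openin X U" "x \<in> U" for U x
  proof -
    obtain \<U> where "\<U> \<subseteq> \<B>" "\<Union>\<U> = U"
      using U(1) unfolding B(1) union_of_def by auto
    then obtain W where "W \<in> \<B>" "x \<in> W" "W \<subseteq> U" using U(2) by blast
    then show ?thesis using b by blast
  qed
  ultimately show ?thesis by (rule has_omega1_baseI)
qed

lemma has_omega1_base_subtopology:
  assumes "has_omega1_base X"
  shows "has_omega1_base (subtopology X S)"
proof -
  obtain B :: "omega1 \<Rightarrow> 'a set" where "\<forall>a. openin X (B a)"
    "\<forall>U x. openin X U \<longrightarrow> x \<in> U \<longrightarrow> (\<exists>a. x \<in> B a \<and> B a \<subseteq> U)"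
    by (rule has_omega1_baseE[OF assms])
  note B = this[rule_format]
  show ?thesis
  proof (rule has_omega1_baseI)
    show "openin (subtopology X S) (B a \<inter> S)" for a
      using B(1) by (rule openin_subtopology_Int)
    show "\<exists>a. x \<in> B a \<inter> S \<and> B a \<inter> S \<subseteq> U" if U: "openin (subtopology X S) U" "x \<in> U" for U x
    proof -
      obtain W where W: "openin X W" "U = W \<inter> S" using U unfolding openin_subtopology by blast
      then obtain a where "x \<in> B a" "B a \<subseteq> W" using B(2)[of W x] U by blast
      then show ?thesis using W U by blast
    qed
  qed
qed

text \<open>
  The set \<open>V a\<close> is the intersection of the first \<open>a\<close> members of a clopen neighbourhood base; it is open
  because \<open>a\<close> has only countably many predecessors.
\<close>

lemma P_base_exists:
  assumes reg: "regular_space X" and P: "P_space X" and base: "has_omega1_base X"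
    and x: "x \<in> topspace X"
  obtains V where "P_base_at X x V"
proof -
  obtain B :: "omega1 \<Rightarrow> 'a set" where "\<forall>a. openin X (B a)"
    "\<forall>U x. openin X U \<longrightarrow> x \<in> U \<longrightarrow> (\<exists>a. x \<in> B a \<and> B a \<subseteq> U)"
    by (rule has_omega1_baseE[OF base])
  note B = this[rule_format]
  \<comment> \<open>Basic sets that miss \<open>x\<close> are replaced by the whole space.\<close>
  have "\<exists>C. openin X C \<and> closedin X C \<and> x \<in> C \<and> (x \<in> B a \<longrightarrow> C \<subseteq> B a)" for a
  proof (cases "x \<in> B a")
    case True
    then show ?thesis using regular_P_space_clopen_neighbourhood[OF reg P B(1)] by metis
  next
    case False
    then show ?thesis using x by (intro exI[of _ "topspace X"]) auto
  qed
  then obtain C where C: "\<And>a. openin X (C a)" "\<And>a. closedin X (C a)" "\<And>a. x \<in> C a"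
    "\<And>a. x \<in> B a \<Longrightarrow> C a \<subseteq> B a"
    by metis
  define V where "V a = topspace X \<inter> (\<Inter>b\<in>{..<a}. C b)" for a :: omega1
  have V_mem: "z \<in> V a \<longleftrightarrow> z \<in> topspace X \<and> (\<forall>b<a. z \<in> C b)" for z a
    by (auto simp: V_def)
  have openV: "openin X (V a)" and closedV: "closedin X (V a)" for a
  proof -
    show "openin X (V a)"
    proof (cases "{..<a} = {}")
      case False
      have "openin X (\<Inter>b\<in>{..<a}. C b)"
        using False C(1) by (intro P_space_countable_Inter[OF P countable_below_omega1])
      then show ?thesis unfolding V_def by (intro openin_Int openin_topspace)
    qed (simp add: V_def)
    show "closedin X (V a)"
    proof (cases "{..<a} = {}")
      case False
      have "closedin X (\<Inter>b\<in>{..<a}. C b)"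
        using False C(2) by (intro closedin_Inter) auto
      then show ?thesis unfolding V_def by (intro closedin_Int closedin_topspace)
    qed (simp add: V_def)
  qed
  have antimonoV: "V a \<subseteq> V b" if "b < a" for a b
  proof
    fix z assume "z \<in> V a"
    then show "z \<in> V b" using that order.strict_trans[OF _ that] by (simp add: V_mem)
  qed
  have "P_base_at X x V"
    unfolding P_base_at_def
  proof (intro conjI allI impI)
    show "x \<in> V a" for a using x C(3) by (simp add: V_def)
    show "V ozero = topspace X"
    proof -
      have "{..<ozero :: omega1} = {}" using leD[OF ozero_le] by blast
      then show ?thesis by (simp add: V_def)
    qed
    show "openin X (V a)" "closedin X (V a)" for a by (fact openV closedV)+
    show "V a \<subseteq> V b" if "b < a" for a b by (rule antimonoV[OF that])
    show "\<exists>a. V a \<subseteq> U" if U: "openin X U \<and> x \<in> U" for U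
    proof -
      obtain b where b: "x \<in> B b" "B b \<subseteq> U" using B(2)[of U x] U by blast
      have "V (osucc b) \<subseteq> C b" using omega1_less_osucc[of b] by (auto simp: V_mem)
      then show ?thesis using C(4)[OF b(1)] b(2) by blast
    qed
    show "V a = (\<Inter>b\<in>{..<a}. V b)" if lim: "is_limit a" for a
    proof
      show "V a \<subseteq> (\<Inter>b\<in>{..<a}. V b)"
        using antimonoV by (intro INT_greatest) simp
      show "(\<Inter>b\<in>{..<a}. V b) \<subseteq> V a"
      proof
        fix z assume z: "z \<in> (\<Inter>b\<in>{..<a}. V b)"
        have "z \<in> C b" if "b < a" for b
        proof -
          have "z \<in> V (osucc b)" using z osucc_less_limit[OF lim that] by simp
          then show ?thesis using omega1_less_osucc[of b] by (simp add: V_mem)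
        qed
        moreover have "z \<in> topspace X"
          using z ozero_less_limit[OF lim] by (auto simp: V_mem)
        ultimately show "z \<in> V a" by (simp add: V_mem)
      qed
    qed
  qed
  then show ?thesis by (rule that)
qed

lemma
  assumes "P_base_at X x V"
  shows P_base_point: "x \<in> V a"
    and P_base_ozero: "V ozero = topspace X"
    and P_base_open: "openin X (V a)"
    and P_base_closed: "closedin X (V a)"
  using assms by (simp_all add: P_base_at_def)

lemma P_base_neighbourhood:
  assumes "P_base_at X x V" "openin X U" "x \<in> U"
  obtains a where "V a \<subseteq> U"
  using assms by (simp add: P_base_at_def) metis

lemma P_base_limit:
  assumes "P_base_at X x V" "is_limit a"
  shows "V a = (\<Inter>b\<in>{..<a}. V b)"
proof -
  have "\<forall>a. is_limit a \<longrightarrow> V a = (\<Inter>b\<in>{..<a}. V b)"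
    using assms(1) unfolding P_base_at_def by (elim conjE)
  then show ?thesis using assms(2) by (elim allE impE)
qed

lemma P_base_antimono:
  assumes "P_base_at X x V" "b \<le> a"
  shows "V a \<subseteq> V b"
  using assms unfolding P_base_at_def by (cases "a = b") auto

lemma P_base_slice_mem_iff:
  assumes V: "P_base_at X x V" and z: "z \<in> V b - V (osucc b)"
  shows "z \<in> V a \<longleftrightarrow> a \<le> b"
proof
  assume a: "z \<in> V a"
  show "a \<le> b"
  proof (rule ccontr)
    assume "\<not> a \<le> b"
    then have "osucc b \<le> a" by (intro osucc_leI) simp
    then show False using P_base_antimono[OF V] a z by blast
  qed
next
  assume "a \<le> b"
  then show "z \<in> V a" using P_base_antimono[OF V] z by blast
qed

lemma P_base_slices_disjoint:
  assumes V: "P_base_at X x V" and "a \<noteq> b"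
  shows "(V a - V (osucc a)) \<inter> (V b - V (osucc b)) = {}"
  using assms P_base_slice_mem_iff[OF V] by (metis antisym disjoint_iff DiffD1)

lemma P_base_slice_clopen:
  assumes "P_base_at X x V"
  shows "openin X (V a - V (osucc a))" "closedin X (V a - V (osucc a))"
  using P_base_open[OF assms] P_base_closed[OF assms] by (auto intro: openin_diff closedin_diff)

text \<open>
  In a \<open>T\<^sub>1\<close> space every point other than \<open>x\<close> eventually leaves the \<open>P\<close>-base, and by continuity at
  limits it does so at a successor step.
\<close>

lemma P_base_slices_cover:
  assumes V: "P_base_at X x V" and t1: "t1_space X"
  shows "topspace X - (\<Union>a. V a - V (osucc a)) = {x}"
proof
  note x = P_base_point[OF V] and V0 = P_base_ozero[OF V]
  show "{x} \<subseteq> topspace X - (\<Union>a. V a - V (osucc a))"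
    using x V0 by blast
  show "topspace X - (\<Union>a. V a - V (osucc a)) \<subseteq> {x}"
  proof
    fix z assume z: "z \<in> topspace X - (\<Union>a. V a - V (osucc a))"
    show "z \<in> {x}"
    proof (rule ccontr)
      assume "z \<notin> {x}"
      then obtain U where U: "openin X U" "x \<in> U" "z \<notin> U"
        using t1 z x V0 unfolding t1_space_def by (metis DiffD1 singletonI)
      then obtain a where "V a \<subseteq> U" using P_base_neighbourhood[OF V] by metis
      then have "z \<notin> V a" using U by blast
      moreover have "z \<in> V ozero" using z V0 by blast
      moreover have "(\<Inter>b\<in>{..<l}. V b) \<subseteq> V l" if "is_limit l" for l
        using P_base_limit[OF V that] by (rule equalityD2)
      ultimately obtain b where "z \<in> V b" "z \<notin> V (osucc b)"
        using last_stage[of z V a] by blast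
      then show False using z by blast
    qed
  qed
qed

text \<open>
  For each basic set that lies in some good clopen set one such clopen set is selected.  The selected sets
  form a cover indexed by \<open>\<omega>\<^sub>1\<close>; subtracting from each member its predecessors keeps it open since there
  are only countably many of them.
\<close>

lemma clopen_partition:
  assumes P: "P_space X" and base: "has_omega1_base X"
    and empty: "Q {}"
    and hered: "\<And>C E. Q E \<Longrightarrow> C \<subseteq> E \<Longrightarrow> Q C"
    and nbhd: "\<And>z. z \<in> topspace X \<Longrightarrow> \<exists>E. z \<in> E \<and> openin X E \<and> closedin X E \<and> Q E"
  obtains D :: "omega1 \<Rightarrow> 'a set"
  where "\<And>a. openin X (D a)" "\<And>a. Q (D a)" "\<And>a b. a \<noteq> b \<Longrightarrow> D a \<inter> D b = {}"
    "(\<Union>a. D a) = topspace X"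
proof -
  obtain B :: "omega1 \<Rightarrow> 'a set" where "\<forall>a. openin X (B a)"
    "\<forall>U x. openin X U \<longrightarrow> x \<in> U \<longrightarrow> (\<exists>a. x \<in> B a \<and> B a \<subseteq> U)"
    by (rule has_omega1_baseE[OF base])
  note B = this[rule_format]
  define ok where "ok E \<longleftrightarrow> openin X E \<and> closedin X E \<and> Q E" for E
  have "\<exists>G. ok G \<and> ((\<exists>E. ok E \<and> B a \<subseteq> E) \<longrightarrow> B a \<subseteq> G)" for a
  proof (cases "\<exists>E. ok E \<and> B a \<subseteq> E")
    case False
    moreover have "ok {}" using empty by (simp add: ok_def)
    ultimately show ?thesis by blast
  qed blast
  then obtain G where G: "\<And>a. ok (G a)" "\<And>a E. ok E \<Longrightarrow> B a \<subseteq> E \<Longrightarrow> B a \<subseteq> G a"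
    by metis
  have G_clopen: "openin X (G a)" "closedin X (G a)" and GQ: "Q (G a)" for a
    using G(1)[of a] unfolding ok_def by blast+
  have G_cover: "\<exists>a. z \<in> G a" if z: "z \<in> topspace X" for z
  proof -
    obtain E where E: "z \<in> E" "ok E" using nbhd[OF z] unfolding ok_def by blast
    then obtain a where "z \<in> B a" "B a \<subseteq> E" using B(2)[of E z] unfolding ok_def by blast
    then show ?thesis using G(2) E by blast
  qed
  define D where "D a = G a - (\<Union>b\<in>{..<a}. G b)" for a
  show ?thesis
  proof (rule that)
    show "openin X (D a)" for a
      unfolding D_def
      using G_clopen by (intro openin_diff P_space_countable_Union_closed[OF P countable_below_omega1])
    show "Q (D a)" for a using GQ[of a] by (rule hered) (auto simp: D_def)
    show "D a \<inter> D b = {}" if "a \<noteq> b" for a b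
      using that by (cases rule: linorder_cases[of a b]) (auto simp: D_def)
    show "(\<Union>a. D a) = topspace X"
    proof
      show "(\<Union>a. D a) \<subseteq> topspace X"
        using openin_subset[OF G_clopen(1)] unfolding D_def by blast
      show "topspace X \<subseteq> (\<Union>a. D a)"
      proof
        fix z assume "z \<in> topspace X"
        then have ex: "\<exists>a. z \<in> G a" by (rule G_cover)
        define a where "a = (LEAST a. z \<in> G a)"
        have "z \<in> G a" unfolding a_def using ex by (rule LeastI_ex)
        moreover have "z \<notin> G b" if "b < a" for b
          using not_less_Least that unfolding a_def by blast
        ultimately show "z \<in> (\<Union>a. D a)" unfolding D_def by blast
      qed
    qed
  qed
qed

section \<open>The spaces J\<close>

text \<open>
  The smaller space is the copy of \<open>J(b)\<close> that was used in building the given \<open>T\<close>, which avoids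
  comparing \<open>T\<close> with an arbitrary copy of \<open>J(b)\<close>.
\<close>

lemma is_J_contains_smaller:
  fixes T :: "'b topology"
  assumes "is_J a T" "b \<le> a"
  shows "\<exists>S :: 'b topology. is_J b S \<and> S \<subset>\<^sub>h T"
  using assms
proof (induction arbitrary: b rule: is_J.induct)
  case (zero T)
  then have "b = ozero" using ozero_le[of b] by simp
  then show ?case using is_J.zero[OF zero(1)] embeds_in_refl[of T] by blast
next
  case (one T x)
  show ?case
  proof (cases "b = osucc ozero")
    case True
    then show ?thesis using is_J.one[OF one(1)] embeds_in_refl[of T] by blast
  next
    case False
    then have "b < osucc ozero" using one by simp
    then have "b = ozero"
      using osucc_leI[of ozero b] ozero_le[of b] by (metis leD order_le_less)
    moreover have "is_J ozero (subtopology T {})" by (rule is_J.zero) simp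
    ultimately show ?thesis using subtopology_embeds_in[of T] by blast
  qed
next
  case (succ c S T x V)
  show ?case
  proof (cases "b = osucc c")
    case True
    moreover have "is_J (osucc c) T" by (rule is_J.succ[OF succ.hyps])
    ultimately show ?thesis using embeds_in_refl[of T] by blast
  next
    case False
    then have "b \<le> c" using succ.prems osucc_leI[of c b] by (metis leD leI order_le_less)
    then obtain R :: "'b topology" where R: "is_J b R" "R \<subset>\<^sub>h S" using succ.IH by blast
    let ?sum = "sum_topology (\<lambda>_ :: omega1. S) UNIV"
    have "S \<subset>\<^sub>h ?sum"
      by (rule sum_component_embeds_in[of ozero UNIV "\<lambda>_. S"]) simp
    moreover have "?sum \<subset>\<^sub>h subtopology T (V ozero - V (osucc ozero))"
      using homeomorphic_space_sym[THEN iffD1, OF succ.hyps(8)[rule_format, of ozero]]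
      by (rule homeomorphic_space_imp_embeds_in)
    ultimately show ?thesis
      using R subtopology_embeds_in[of T] by (blast intro: embeds_in_trans)
  qed
next
  case (limit c S T)
  show ?case
  proof (cases "b = c")
    case True
    have "is_J c T" using limit.IH by (intro is_J.limit[OF limit.hyps(1) _ limit.hyps(2)]) blast
    then show ?thesis using True embeds_in_refl[of T] by blast
  next
    case False
    then have b: "b < c" using limit.prems by simp
    then have "S b \<subset>\<^sub>h sum_topology S {..<c}" by (intro sum_component_embeds_in) simp
    moreover have "sum_topology S {..<c} \<subset>\<^sub>h T"
      using homeomorphic_space_sym[THEN iffD1, OF limit.hyps(2)]
      by (rule homeomorphic_space_imp_embeds_in)
    moreover have "is_J b (S b)" using b limit.IH by blast
    ultimately show ?thesis by (blast intro: embeds_in_trans)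
  qed
qed

lemma is_J_osucc_cases:
  fixes T :: "'b topology"
  assumes "is_J (osucc a) T"
  obtains x where "a = ozero" "topspace T = {x}"
  | S :: "'b topology" and x V where "is_J a S" "t1_space T" "P_base_at T x V"
      "\<And>b :: omega1. subtopology T (V b - V (osucc b)) homeomorphic_space
         sum_topology (\<lambda>_ :: omega1. S) UNIV"
  using assms
proof (cases rule: is_J.cases)
  case zero
  then show ?thesis using omega2_less_osucc[of a] ozero_le[of a] by simp
next
  case (one x)
  then show ?thesis using that(1) osucc_inject_omega2 by blast
next
  case (succ c S x V)
  then have "a = c" using osucc_inject_omega2 by blast
  then show ?thesis using that(2)[of S x V] succ by blast
next
  case (limit S)
  then show ?thesis using omega2_less_osucc[of a] unfolding is_limit_def is_successor_def by blast
qed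

section \<open>The embedding\<close>

text \<open>
  The glued map \<open>f\<close> satisfies \<open>f z \<in> W a \<longleftrightarrow> z \<in> V a\<close>, since \<open>z\<close> and \<open>f z\<close> lie in slices with the same index.
  This makes \<open>f\<close> continuous and open onto its image at \<open>y\<close>; at the other points \<open>embedding_map_from_pieces\<close> applies.
\<close>

lemma embeds_in_slicewise:
  assumes V: "P_base_at X y V" "t1_space X" and W: "P_base_at T x W" "t1_space T"
    and slices: "\<And>a. subtopology X (V a - V (osucc a)) \<subset>\<^sub>h subtopology T (W a - W (osucc a))"
  shows "X \<subset>\<^sub>h T"
proof -
  let ?D = "\<lambda>a. V a - V (osucc a)" and ?E = "\<lambda>a. W a - W (osucc a)"
  obtain g where g: "\<And>a. embedding_map (subtopology X (?D a)) (subtopology T (?E a)) (g a)"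
    using slices unfolding embeds_in_iff_embedding_map by metis
  have coverX: "topspace X - (\<Union>a. ?D a) = {y}" and coverT: "topspace T - (\<Union>a. ?E a) = {x}"
    by (rule P_base_slices_cover[OF V] P_base_slices_cover[OF W])+
  define idx where "idx z = (THE a. z \<in> ?D a)" for z
  have idx: "idx z = a" if "z \<in> ?D a" for z a
    unfolding idx_def
  proof (rule the_equality)
    show "z \<in> ?D a" by (rule that)
    fix b assume "z \<in> ?D b"
    then show "b = a" using that P_base_slices_disjoint[OF V(1), of a b] by blast
  qed
  define f where "f z = (if z = y then x else g (idx z) z)" for z
  note yV = P_base_point[OF V(1)] and xW = P_base_point[OF W(1)]
  have f_slice: "f z = g a z" if "z \<in> ?D a" for z a
    using that idx[OF that] yV by (auto simp: f_def)
  have DX: "?D a \<subseteq> topspace X" for a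
    using openin_subset[OF P_base_slice_clopen(1)[OF V(1)]] .
  have f_img: "f ` ?D a \<subseteq> ?E a" for a
  proof -
    have "g a ` ?D a \<subseteq> ?E a"
      using g[of a] DX[of a] unfolding embedding_map_in_subtopology by (simp add: Int_absorb1)
    then show ?thesis using f_slice by force
  qed
  have f_mem: "f z \<in> W a \<longleftrightarrow> z \<in> V a" if z: "z \<in> topspace X" for z a
  proof (cases "z = y")
    case True
    then show ?thesis using yV xW by (simp add: f_def)
  next
    case False
    then obtain b where b: "z \<in> ?D b" using z coverX by blast
    then have "f z \<in> ?E b" using f_img by blast
    then show ?thesis
      using P_base_slice_mem_iff[OF V(1) b] P_base_slice_mem_iff[OF W(1)] by blast
  qed
  note VX = P_base_open[OF V(1)] and WT = P_base_open[OF W(1)]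
  have "embedding_map X T f"
  proof (rule embedding_map_from_pieces[where D = ?D and W = ?E and P = "{y}"])
    show "openin X (?D a)" "openin T (?E a)" for a
      by (rule P_base_slice_clopen(1)[OF V(1)] P_base_slice_clopen(1)[OF W(1)])+
    show "?E a \<inter> ?E b = {}" if "a \<noteq> b" for a b
      using P_base_slices_disjoint[OF W(1) that] .
    show "embedding_map (subtopology X (?D a)) T f" for a
    proof (rule embedding_map_eq)
      show "embedding_map (subtopology X (?D a)) T (g a)"
        using g[of a] unfolding embedding_map_in_subtopology by blast
      show "g a z = f z" if "z \<in> topspace (subtopology X (?D a))" for z
        using that f_slice[of z a] by simp
    qed
    show "f ` ?D a \<subseteq> ?E a" for a by (rule f_img)
    show "{y} = topspace X - (\<Union>a. ?D a)" using coverX by (rule sym)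
    show "inj_on f {y}" by simp
    show "f ` {y} \<subseteq> topspace T - (\<Union>a. ?E a)" unfolding coverT by (simp add: f_def)
    show "\<exists>U. openin X U \<and> z \<in> U \<and> f ` U \<subseteq> O'" if z: "z \<in> {y}" "openin T O'" "f z \<in> O'" for z O'
    proof -
      have "x \<in> O'" using z by (simp add: f_def)
      then obtain a where a: "W a \<subseteq> O'" using P_base_neighbourhood[OF W(1) z(2)] by blast
      have "f ` V a \<subseteq> W a" using f_mem openin_subset[OF VX[of a]] by blast
      then show ?thesis using a VX[of a] yV[of a] z by blast
    qed
    show "\<exists>O'. openin T O' \<and> f z \<in> O' \<and> (\<forall>u\<in>topspace X. f u \<in> O' \<longrightarrow> u \<in> U)"
      if z: "z \<in> {y}" "z \<in> U" "openin X U" for z U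
    proof -
      obtain a where "V a \<subseteq> U" using P_base_neighbourhood[OF V(1) z(3)] z(1,2) by blast
      moreover have "f z \<in> W a" using z xW by (simp add: f_def)
      ultimately show ?thesis using WT[of a] f_mem by blast
    qed
  qed
  then show ?thesis unfolding embeds_in_iff_embedding_map by blast
qed

text \<open>
  The point \<open>z\<close> is isolated in the last derivative containing it.  The induction for the
  embedding theorem applies to \<open>C\<close> with the smaller ordinal \<open>b\<close>.
\<close>

lemma clopen_neighbourhood_of_rank:
  fixes a :: "'o::wellorder"
  assumes reg: "regular_space X" and P: "P_space X"
    and U: "openin X U" "z \<in> U" and z: "z \<notin> CB_derivative X a"
  obtains b C where "b < a" "openin X C" "closedin X C" "z \<in> C" "C \<subseteq> U"
    "CB_derivative (subtopology X C) b = {z}"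
proof -
  have z0: "z \<in> CB_derivative X (ozero :: 'o)"
    using U openin_subset by (auto simp: CB_derivative_ozero)
  have lim: "(\<Inter>b\<in>{..<l}. CB_derivative X b) \<subseteq> CB_derivative X l" if "is_limit l" for l :: 'o
    using CB_derivative_limit[OF that, of X] by simp
  obtain b where b: "b < a" "z \<in> CB_derivative X b" "z \<notin> CB_derivative X (osucc b)"
    using last_stage[OF z0 z lim] by blast
  then have "openin (subtopology X (CB_derivative X b)) {z}"
    unfolding CB_derivative_osucc[OF less_osucc[OF b(1)]] CB_derivative_set_def by blast
  then obtain W where W: "openin X W" "{z} = W \<inter> CB_derivative X b"
    unfolding openin_subtopology by blast
  have "openin X (U \<inter> W)" "z \<in> U \<inter> W" using U W by auto
  then obtain C where C: "openin X C" "closedin X C" "z \<in> C" "C \<subseteq> U \<inter> W"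
    using regular_P_space_clopen_neighbourhood[OF reg P] by metis
  have "CB_derivative (subtopology X C) b = {z}"
    unfolding CB_derivative_open_subspace[OF C(1)] using C W b(2) by blast
  then show ?thesis using that b(1) C by blast
qed

text \<open>
  This is the inductive form of the embedding theorem.  The weight is bounded only from above because clopen
  subspaces may have smaller weight.
\<close>

lemma embeds_in_J:
  fixes a :: omega2 and X :: "'a topology" and T :: "'b topology"
  assumes "regular_space X" "t1_space X" "P_space X" "has_omega1_base X"
    and "CB_derivative X a = {y}" and "is_J (osucc a) T"
  shows "X \<subset>\<^sub>h T"
  using assms
proof (induction a arbitrary: X y T rule: less_induct)
  case (less a)
  note reg = less.prems(1) and t1 = less.prems(2) and P = less.prems(3) and base = less.prems(4)
    and top = less.prems(5)
  have y: "y \<in> topspace X" using top CB_derivative_subset_topspace[of X a] by blast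
  show ?case
  proof (cases rule: is_J_osucc_cases[OF less.prems(6)])
    case (1 x)
    have Xy: "topspace X = {y}" using top 1(1) by (simp add: CB_derivative_ozero)
    have "embedding_map X T (\<lambda>_. x)"
    proof (rule embedding_mapI_pointwise)
      show "\<exists>U. openin X U \<and> z \<in> U \<and> (\<lambda>_. x) ` U \<subseteq> W" if "z \<in> topspace X" "x \<in> W" for z W
        using that by (intro exI[of _ "topspace X"]) auto
      show "\<exists>W. openin T W \<and> x \<in> W \<and> (\<forall>u\<in>topspace X. x \<in> W \<longrightarrow> u \<in> U)"
        if "z \<in> U" "openin X U" for z U
      proof -
        have "u \<in> U" if "u \<in> topspace X" for u
          using that \<open>z \<in> U\<close> openin_subset[OF \<open>openin X U\<close>] Xy by auto
        moreover have "x \<in> topspace T" using 1(2) by simp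
        ultimately show ?thesis using openin_topspace[of T] by blast
      qed
    qed (use Xy 1(2) in auto)
    then show ?thesis unfolding embeds_in_iff_embedding_map by blast
  next
    case (2 S x W)
    obtain V where V: "P_base_at X y V"
      using P_base_exists[OF reg P base y] by blast
    have "subtopology X (V c - V (osucc c)) \<subset>\<^sub>h subtopology T (W c - W (osucc c))" for c
    proof -
      let ?D = "V c - V (osucc c)"
      let ?Z = "subtopology X ?D"
      have D: "openin X ?D" "closedin X ?D" by (rule P_base_slice_clopen[OF V])+
      have yD: "y \<notin> ?D" using P_base_point[OF V] by blast
      have tZ: "topspace ?Z = ?D" using openin_subset[OF D(1)] by auto
      have nbhd: "\<exists>E. z \<in> E \<and> openin ?Z E \<and> closedin ?Z E \<and> subtopology ?Z E \<subset>\<^sub>h S"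
        if "z \<in> topspace ?Z" for z
      proof -
        have z: "z \<in> ?D" using that tZ by blast
        then have "z \<notin> CB_derivative X a" using yD unfolding top by blast
        then obtain b C where b: "b < a" and C: "openin X C" "closedin X C" "z \<in> C" "C \<subseteq> ?D"
          and CB: "CB_derivative (subtopology X C) b = {z}"
          using clopen_neighbourhood_of_rank[OF reg P D(1) z] by metis
        obtain R :: "'b topology" where R: "is_J (osucc b) R" "R \<subset>\<^sub>h S"
          using is_J_contains_smaller[OF 2(1) osucc_leI[OF b]] by blast
        have "subtopology X C \<subset>\<^sub>h R"
          by (rule less.IH[OF b _ _ _ _ CB R(1)])
            (simp_all add: reg t1 P base regular_space_subtopology t1_space_subtopology
              P_space_subtopology has_omega1_base_subtopology)
        moreover have "subtopology ?Z C = subtopology X C"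
          using C(4) by (simp add: subtopology_subtopology Int_absorb1)
        ultimately have "subtopology ?Z C \<subset>\<^sub>h S" using R(2) embeds_in_trans by metis
        moreover have "openin ?Z C" "closedin ?Z C"
          using C openin_open_subtopology[OF D(1)] closedin_closed_subtopology[OF D(2)] by blast+
        ultimately show ?thesis using C(3) by blast
      qed
      obtain E :: "omega1 \<Rightarrow> 'a set" where E: "\<And>a. openin ?Z (E a)"
        "\<And>a. subtopology ?Z (E a) \<subset>\<^sub>h S" "\<And>a b. a \<noteq> b \<Longrightarrow> E a \<inter> E b = {}"
        "(\<Union>a. E a) = topspace ?Z"
      proof (rule clopen_partition[of ?Z "\<lambda>E. subtopology ?Z E \<subset>\<^sub>h S"])
        show "P_space ?Z" using P by (rule P_space_subtopology)
        show "has_omega1_base ?Z" using base by (rule has_omega1_base_subtopology)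
        show "subtopology ?Z {} \<subset>\<^sub>h S"
        proof -
          have "embedding_map (subtopology ?Z {}) S (\<lambda>_. undefined)"
          proof (rule embedding_mapI_pointwise)
            fix z U assume z: "z \<in> U" and U: "openin (subtopology ?Z {}) U"
            have "U \<subseteq> {}" using openin_subset[OF U] by simp
            then show "\<exists>W. openin S W \<and> undefined \<in> W \<and> (\<forall>u\<in>topspace (subtopology ?Z {}). undefined \<in> W \<longrightarrow> u \<in> U)"
              using z by blast
          qed simp_all
          then show ?thesis unfolding embeds_in_iff_embedding_map by blast
        qed
        show "subtopology ?Z C \<subset>\<^sub>h S" if E: "subtopology ?Z E \<subset>\<^sub>h S" and CE: "C \<subseteq> E" for C E
        proof -
          have "subtopology ?Z C = subtopology (subtopology ?Z E) C"
            using CE by (simp add: subtopology_subtopology[of ?Z] Int_absorb1)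
          then show ?thesis using subtopology_embeds_in[of "subtopology ?Z E" C] E embeds_in_trans by metis
        qed
      qed (use nbhd that in blast)+
      have "?Z \<subset>\<^sub>h sum_topology (\<lambda>_ :: omega1. S) UNIV"
        by (rule embeds_in_sum_of_copies[OF E(1,3,4,2)])
      moreover have "sum_topology (\<lambda>_ :: omega1. S) UNIV \<subset>\<^sub>h subtopology T (W c - W (osucc c))"
        using homeomorphic_space_sym[THEN iffD1, OF 2(4)[of c]]
        by (rule homeomorphic_space_imp_embeds_in)
      ultimately show ?thesis by (rule embeds_in_trans)
    qed
    then show ?thesis by (rule embeds_in_slicewise[OF V t1 2(3,2)])
  qed
qed

theorem proposition20:
  fixes \<alpha> :: omega2
    and X :: "'a topology" and Y :: "'a set"
    and J :: "'b topology"
  assumes "elementary_set X Y"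
    and "has_weight (subtopology X Y) (cardSuc natLeq)"
    and "has_CB_rank (subtopology X Y) (osucc \<alpha>)"
    and "is_J (osucc \<alpha>) J"
  shows "subtopology X Y \<subset>\<^sub>h J"
proof -
  have X: "regular_space X" "t1_space X" "P_space X"
    using assms(1) unfolding elementary_set_def by blast+
  obtain \<mu> :: "'a suc" and x where \<mu>: "\<mu> < osucc \<mu>" "has_CB_rank (subtopology X Y) (osucc \<mu>)"
    and x: "CB_derivative (subtopology X Y) \<mu> = {x}"
    using assms(1) unfolding elementary_set_def by blast
  have "CB_derivative (subtopology X Y) \<alpha> = CB_derivative (subtopology X Y) \<mu>"
    by (rule last_CB_derivative_unique[OF assms(3) omega2_less_osucc \<mu>(2,1)])
  then have top: "CB_derivative (subtopology X Y) \<alpha> = {x}" using x by simp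
  show ?thesis
    by (rule embeds_in_J[OF _ _ _ _ top assms(4)])
      (simp_all add: X regular_space_subtopology t1_space_subtopology P_space_subtopology
        has_weight_imp_has_omega1_base[OF assms(2)])
qed

end
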